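(* The braid group $B_3=\langle \sigma_1,\sigma_2 : \sigma_1\sigma_2\sigma_1=\sigma_2\sigma_1\sigma_2\rangle$ is conjugacy separable.
   Context: A group $G$ is conjugacy separable if $g,h\in G$ are conjugate in $G$ whenever the images of $g$ and $h$ are conjugate in all finite quotients of $G$; equivalently, for each pair of non-conjugate elements $g,h\in G$ there is a finite index normal subgroup $N\subseteq G$ (depending on $g$ and $h$) such that the images of $g$ and $h$ in $G/N$ are non-conjugate in $G/N$. *)

theory Defs
  imports "HOL-Algebra.Coset"
begin

section \<open>Groups given by generators and relations\<close>

text \<open>The letter \<open>(True, x)\<close> stands for the generator \<open>x\<close>, the letter \<open>(False, x)\<close> for its
  formal inverse. The generators are all elements of the type \<open>'a\<close>.\<close>

type_synonym 'a gword = "(bool \<times> 'a) list"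

definition inv_gword :: "'a gword \<Rightarrow> 'a gword" where
  "inv_gword w = rev (map (\<lambda>(b, x). (\<not> b, x)) w)"

text \<open>The least congruence on words that contains free cancellation and the relations
  \<open>l = r\<close> for \<open>(l, r) \<in> R\<close>.\<close>

inductive pres_eq :: "('a gword \<times> 'a gword) set \<Rightarrow> 'a gword \<Rightarrow> 'a gword \<Rightarrow> bool"
  for R :: "('a gword \<times> 'a gword) set" where
  refl: "pres_eq R u u"
| sym: "pres_eq R u v \<Longrightarrow> pres_eq R v u"
| trans: "pres_eq R u v \<Longrightarrow> pres_eq R v w \<Longrightarrow> pres_eq R u w"
| append: "pres_eq R u u' \<Longrightarrow> pres_eq R v v' \<Longrightarrow> pres_eq R (u @ v) (u' @ v')"
| cancel: "pres_eq R [(b, x), (\<not> b, x)] []"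
| rel: "(l, r) \<in> R \<Longrightarrow> pres_eq R l r"

definition pres_class :: "('a gword \<times> 'a gword) set \<Rightarrow> 'a gword \<Rightarrow> 'a gword set" where
  "pres_class R u = {v. pres_eq R u v}"

definition presented_group :: "('a gword \<times> 'a gword) set \<Rightarrow> 'a gword set monoid" where
  "presented_group R =
     \<lparr>carrier = range (pres_class R),
      mult = (\<lambda>X Y. {w. \<exists>u\<in>X. \<exists>v\<in>Y. pres_eq R (u @ v) w}),
      one = pres_class R []\<rparr>"

lemma pres_class_eq_iff: "pres_class R u = pres_class R v \<longleftrightarrow> pres_eq R u v"
  unfolding pres_class_def by (auto intro: pres_eq.refl pres_eq.sym pres_eq.trans)

lemma carrier_presented_group: "carrier (presented_group R) = range (pres_class R)"
  by (simp add: presented_group_def)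

lemma one_presented_group: "\<one>\<^bsub>presented_group R\<^esub> = pres_class R []"
  by (simp add: presented_group_def)

lemma mult_presented_group:
  "pres_class R u \<otimes>\<^bsub>presented_group R\<^esub> pres_class R v = pres_class R (u @ v)"
  unfolding presented_group_def pres_class_def
  by (auto intro: pres_eq.refl pres_eq.trans pres_eq.append)

lemma pres_eq_inv_gword: "pres_eq R (inv_gword w @ w) []"
proof (induction w)
  case Nil
  show ?case by (simp add: inv_gword_def pres_eq.refl)
next
  case (Cons a w)
  obtain b x where a: "a = (b, x)" by (cases a)
  have "pres_eq R [(\<not> b, x), (b, x)] []"
    using pres_eq.cancel[of R "\<not> b" x] by simp
  then have "pres_eq R (inv_gword w @ ([(\<not> b, x), (b, x)] @ w)) (inv_gword w @ ([] @ w))"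
    by (intro pres_eq.append pres_eq.refl)
  then have "pres_eq R (inv_gword (a # w) @ (a # w)) (inv_gword w @ w)"
    by (simp add: inv_gword_def a)
  then show ?case using Cons.IH by (rule pres_eq.trans)
qed

lemma group_presented_group: "group (presented_group R)"
proof (rule groupI)
  fix X assume "X \<in> carrier (presented_group R)"
  then obtain u where "X = pres_class R u" by (auto simp: carrier_presented_group)
  then have "pres_class R (inv_gword u) \<otimes>\<^bsub>presented_group R\<^esub> X = \<one>\<^bsub>presented_group R\<^esub>"
    by (simp add: mult_presented_group one_presented_group pres_class_eq_iff pres_eq_inv_gword)
  then show "\<exists>Y\<in>carrier (presented_group R). Y \<otimes>\<^bsub>presented_group R\<^esub> X = \<one>\<^bsub>presented_group R\<^esub>"
    by (auto simp: carrier_presented_group)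
qed (auto simp: carrier_presented_group one_presented_group mult_presented_group)


section \<open>The braid group on three strands\<close>

datatype braid_gen = \<sigma>\<^sub>1 | \<sigma>\<^sub>2

definition braid_group_3 :: "braid_gen gword set monoid" (\<open>B\<^sub>3\<close>) where
  "B\<^sub>3 = presented_group
     {([(True, \<sigma>\<^sub>1), (True, \<sigma>\<^sub>2), (True, \<sigma>\<^sub>1)], [(True, \<sigma>\<^sub>2), (True, \<sigma>\<^sub>1), (True, \<sigma>\<^sub>2)])}"

lemma group_braid_group_3: "group B\<^sub>3"
  unfolding braid_group_3_def by (rule group_presented_group)


section \<open>Conjugacy separability\<close>

definition conjugate_in :: "('a, 'b) monoid_scheme \<Rightarrow> 'a \<Rightarrow> 'a \<Rightarrow> bool" where
  "conjugate_in G g h \<longleftrightarrow> (\<exists>x\<in>carrier G. h = x \<otimes>\<^bsub>G\<^esub> g \<otimes>\<^bsub>G\<^esub> inv\<^bsub>G\<^esub> x)"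

text \<open>The image of \<open>g\<close> in the quotient \<open>G Mod N\<close> is the coset \<open>N #>\<^bsub>G\<^esub> g\<close>.\<close>

definition conjugacy_separable :: "('a, 'b) monoid_scheme \<Rightarrow> bool" where
  "conjugacy_separable G \<longleftrightarrow> group G \<and>
     (\<forall>g\<in>carrier G. \<forall>h\<in>carrier G.
        (\<forall>N. N \<lhd> G \<and> finite (carrier (G Mod N)) \<longrightarrow>
             conjugate_in (G Mod N) (N #>\<^bsub>G\<^esub> g) (N #>\<^bsub>G\<^esub> h)) \<longrightarrow>
        conjugate_in G g h)"

end

theory Submission
  imports Defs "HOL-Algebra.Elementary_Groups" "HOL-Combinatorics.Permutations"
begin

text \<open>With \<open>a = \<sigma>\<^sub>1\<sigma>\<^sub>2\<sigma>\<^sub>1\<close> and \<open>b = \<sigma>\<^sub>1\<sigma>\<^sub>2\<close> the braid group is \<open>\<langle>a, b : a\<^sup>2 = b\<^sup>3\<rangle>\<close>, and \<open>a\<^sup>2\<close> is central.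
  Since the exponent sum of \<open>a\<^sup>2\<close> is \<open>6 \<noteq> 0\<close>, two braids are conjugate iff they have the same
  exponent sum and are conjugate modulo \<open>a\<^sup>2\<close>, that is, in \<open>\<int>/2 * \<int>/3\<close>. There, every element is
  conjugate to \<open>a\<close>, \<open>b\<close>, \<open>b\<^sup>2\<close> or a product of syllables \<open>a b\<^sup>e\<close> with \<open>e \<in> {1, 2}\<close>, and the class
  of the latter is determined by the cyclic word of the exponents \<open>e\<close>. Exponent sums are separated by finite cyclic
  quotients. Given a cyclic word of length \<open>n\<close>, let \<open>\<int>/2 * \<int>/3\<close> act on a ring of \<open>3n\<close> triangles: \<open>b\<close>
  rotates each triangle, and \<open>a\<close> moves from the exit vertex of a triangle, chosen according to the
  word, to the entry vertex of the previous one, and back. The ring has a symmetry \<open>\<tau>\<close> which goes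
  back by \<open>n\<close> triangles. A product of at most \<open>n\<close> syllables can act on some point like \<open>\<tau>\<close> only if
  each syllable goes back one triangle, in which case it spells a rotation of the given word.
  Acting like \<open>\<tau>\<close> on some point is invariant under conjugation in the centralizer of \<open>\<tau>\<close>.\<close>

section \<open>Conjugacy in finite quotients\<close>

lemma conjugate_in_hom:
  assumes "\<phi> \<in> hom G H" "group G" "group H" "g \<in> carrier G" "conjugate_in G g h"
  shows "conjugate_in H (\<phi> g) (\<phi> h)"
proof -
  interpret group_hom G H \<phi>
    using assms by (simp add: group_hom_def group_hom_axioms_def)
  from assms(5) obtain x where "x \<in> carrier G" "h = x \<otimes>\<^bsub>G\<^esub> g \<otimes>\<^bsub>G\<^esub> inv\<^bsub>G\<^esub> x"
    by (auto simp: conjugate_in_def)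
  with assms(4) show ?thesis
    unfolding conjugate_in_def by (intro bexI[of _ "\<phi> x"]) auto
qed

lemma conjugate_in_finite_image:
  assumes "\<phi> \<in> hom G H" "group G" "group H" "finite (carrier H)"
    and "g \<in> carrier G" "h \<in> carrier G"
    and sep: "\<And>N. N \<lhd> G \<Longrightarrow> finite (carrier (G Mod N)) \<Longrightarrow>
      conjugate_in (G Mod N) (N #>\<^bsub>G\<^esub> g) (N #>\<^bsub>G\<^esub> h)"
  shows "conjugate_in H (\<phi> g) (\<phi> h)"
proof -
  interpret group_hom G H \<phi>
    using assms by (simp add: group_hom_def group_hom_axioms_def)
  let ?N = "kernel G H \<phi>" and ?f = "\<lambda>X. the_elem (\<phi> ` X)"
  have hom: "?f \<in> hom (G Mod ?N) H"
    by (rule FactGroup_hom)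
  have "?f ` carrier (G Mod ?N) \<subseteq> carrier H"
    using hom by (auto simp: hom_def)
  then have "finite (carrier (G Mod ?N))"
    using FactGroup_inj_on assms(4) by (meson finite_imageD finite_subset)
  then have conj: "conjugate_in (G Mod ?N) (?N #>\<^bsub>G\<^esub> g) (?N #>\<^bsub>G\<^esub> h)"
    by (intro sep normal_kernel)
  have f: "?f (?N #>\<^bsub>G\<^esub> x) = \<phi> x" if "x \<in> carrier G" for x
  proof -
    have "x \<in> ?N #>\<^bsub>G\<^esub> x"
      by (rule G.rcos_self[OF that subgroup_kernel])
    moreover have "\<phi> y = \<phi> x" if "y \<in> ?N #>\<^bsub>G\<^esub> x" for y
      using that \<open>x \<in> carrier G\<close> by (auto simp: r_coset_def kernel_def)
    ultimately have "\<phi> ` (?N #>\<^bsub>G\<^esub> x) = {\<phi> x}" by blast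
    then show ?thesis by simp
  qed
  have "?N #>\<^bsub>G\<^esub> g \<in> carrier (G Mod ?N)"
    using assms(5) by (auto simp: FactGroup_def RCOSETS_def)
  from conjugate_in_hom[OF hom normal.factorgroup_is_group[OF normal_kernel] assms(3) this conj]
  show ?thesis using assms(5,6) by (simp add: f)
qed

lemma conjugate_in_sym:
  assumes "group G" "g \<in> carrier G" "conjugate_in G g h"
  shows "conjugate_in G h g"
proof -
  interpret group G by fact
  from assms obtain x where x: "x \<in> carrier G" "h = x \<otimes>\<^bsub>G\<^esub> g \<otimes>\<^bsub>G\<^esub> inv\<^bsub>G\<^esub> x"
    by (auto simp: conjugate_in_def)
  then have "inv\<^bsub>G\<^esub> x \<otimes>\<^bsub>G\<^esub> h \<otimes>\<^bsub>G\<^esub> inv\<^bsub>G\<^esub> (inv\<^bsub>G\<^esub> x) =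
      (inv\<^bsub>G\<^esub> x \<otimes>\<^bsub>G\<^esub> x) \<otimes>\<^bsub>G\<^esub> g \<otimes>\<^bsub>G\<^esub> (inv\<^bsub>G\<^esub> x \<otimes>\<^bsub>G\<^esub> x)"
    using assms(2) by (simp only: inv_inv m_assoc m_closed inv_closed)
  also have "\<dots> = g" using x assms(2) by simp
  finally show ?thesis
    unfolding conjugate_in_def using x by (intro bexI[of _ "inv\<^bsub>G\<^esub> x"]) auto
qed

lemma conjugate_in_trans:
  assumes "group G" "g \<in> carrier G" "conjugate_in G g h" "conjugate_in G h k"
  shows "conjugate_in G g k"
proof -
  interpret group G by fact
  from assms obtain x y where xy: "x \<in> carrier G" "y \<in> carrier G"
    and h: "h = x \<otimes>\<^bsub>G\<^esub> g \<otimes>\<^bsub>G\<^esub> inv\<^bsub>G\<^esub> x" and k: "k = y \<otimes>\<^bsub>G\<^esub> h \<otimes>\<^bsub>G\<^esub> inv\<^bsub>G\<^esub> y"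
    by (auto simp: conjugate_in_def)
  then have "k = (y \<otimes>\<^bsub>G\<^esub> x) \<otimes>\<^bsub>G\<^esub> g \<otimes>\<^bsub>G\<^esub> inv\<^bsub>G\<^esub> (y \<otimes>\<^bsub>G\<^esub> x)"
    using assms(2) by (simp add: m_assoc inv_mult_group)
  then show ?thesis
    unfolding conjugate_in_def using xy by (intro bexI[of _ "y \<otimes>\<^bsub>G\<^esub> x"]) auto
qed

definition conjugate_in_finite_quotients :: "('a, 'b) monoid_scheme \<Rightarrow> 'a \<Rightarrow> 'a \<Rightarrow> bool" where
  "conjugate_in_finite_quotients G g h \<longleftrightarrow>
    (\<forall>N. N \<lhd> G \<and> finite (carrier (G Mod N)) \<longrightarrow>
      conjugate_in (G Mod N) (N #>\<^bsub>G\<^esub> g) (N #>\<^bsub>G\<^esub> h))"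

lemma conjugate_in_finite_quotients_sym:
  assumes "g \<in> carrier G" "conjugate_in_finite_quotients G g h"
  shows "conjugate_in_finite_quotients G h g"
  unfolding conjugate_in_finite_quotients_def
proof (intro allI impI)
  fix N assume N: "N \<lhd> G \<and> finite (carrier (G Mod N))"
  have "N #>\<^bsub>G\<^esub> g \<in> carrier (G Mod N)"
    using assms(1) by (auto simp: FactGroup_def RCOSETS_def)
  then show "conjugate_in (G Mod N) (N #>\<^bsub>G\<^esub> h) (N #>\<^bsub>G\<^esub> g)"
    using assms(2) N
    by (auto simp: conjugate_in_finite_quotients_def
        intro: conjugate_in_sym normal.factorgroup_is_group)
qed

lemma integer_hom_eq_if_conjugate_in_finite_quotients:
  assumes "group G" "e \<in> hom G integer_group" "g \<in> carrier G" "h \<in> carrier G"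
    and "conjugate_in_finite_quotients G g h"
  shows "e g = e h"
proof -
  define m where "m = nat (\<bar>e g - e h\<bar> + 1)"
  have m: "int m = \<bar>e g - e h\<bar> + 1" by (simp add: m_def)
  let ?M = "integer_mod_group m" and ?\<psi> = "\<lambda>x. e x mod int m"
  have carrier_M: "carrier ?M = {0..<int m}" using m by (simp add: carrier_integer_mod_group)
  have "?\<psi> \<in> hom G ?M"
    using assms(2) m pos_mod_bound[of "int m"] by (auto simp: hom_def carrier_M mod_add_eq)
  then have "conjugate_in ?M (?\<psi> g) (?\<psi> h)"
    using assms by (intro conjugate_in_finite_image[of ?\<psi> G ?M])
      (auto simp: carrier_M conjugate_in_finite_quotients_def)
  then obtain x where "x \<in> carrier ?M" "?\<psi> h = x \<otimes>\<^bsub>?M\<^esub> ?\<psi> g \<otimes>\<^bsub>?M\<^esub> inv\<^bsub>?M\<^esub> x"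
    by (auto simp: conjugate_in_def)
  then have "e h mod int m = (x + e g + - x) mod int m"
    by (simp add: mod_simps)
  then have "int m dvd e h - e g" by (simp add: mod_eq_dvd_iff)
  then show ?thesis
    using dvd_imp_le_int[of "e h - e g" "int m"] m
    by (cases "e h = e g") (auto simp: abs_minus_commute)
qed

section \<open>Homomorphisms from presented groups\<close>

primrec eval_gword :: "('g, 'm) monoid_scheme \<Rightarrow> ('a \<Rightarrow> 'g) \<Rightarrow> 'a gword \<Rightarrow> 'g" where
  "eval_gword G s [] = \<one>\<^bsub>G\<^esub>"
| "eval_gword G s (l # w) =
    (if fst l then s (snd l) else inv\<^bsub>G\<^esub> s (snd l)) \<otimes>\<^bsub>G\<^esub> eval_gword G s w"

lemma (in group) eval_gword_closed:
  assumes "range s \<subseteq> carrier G" shows "eval_gword G s w \<in> carrier G"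
  using assms by (induction w) auto

lemma (in group) eval_gword_append:
  assumes "range s \<subseteq> carrier G"
  shows "eval_gword G s (u @ v) = eval_gword G s u \<otimes> eval_gword G s v"
proof (induction u)
  case (Cons l u)
  have "s (snd l) \<in> carrier G" using assms by auto
  then show ?case using Cons by (simp add: eval_gword_closed[OF assms] m_assoc)
qed (simp add: eval_gword_closed[OF assms])

lemma (in group) eval_gword_pres_eq:
  assumes s: "range s \<subseteq> carrier G"
    and R: "\<And>l r. (l, r) \<in> R \<Longrightarrow> eval_gword G s l = eval_gword G s r"
    and "pres_eq R u v"
  shows "eval_gword G s u = eval_gword G s v"
  using assms(3)
proof induction
  case (cancel b x)
  have "s x \<in> carrier G" using s by auto
  then show ?case by simp
qed (auto simp: eval_gword_append[OF s] R)

lemma (in group) presented_group_hom: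
  assumes s: "range s \<subseteq> carrier G"
    and R: "\<And>l r. (l, r) \<in> R \<Longrightarrow> eval_gword G s l = eval_gword G s r"
  obtains \<phi> where "\<phi> \<in> hom (presented_group R) G"
    and "\<And>u. \<phi> (pres_class R u) = eval_gword G s u"
proof
  define \<phi> where "\<phi> X = eval_gword G s (SOME u. X = pres_class R u)" for X
  show \<phi>: "\<phi> (pres_class R u) = eval_gword G s u" for u
  proof -
    have "pres_class R u = pres_class R (SOME v. pres_class R u = pres_class R v)"
      by (rule someI) (rule HOL.refl)
    then have "pres_eq R u (SOME v. pres_class R u = pres_class R v)"
      by (simp add: pres_class_eq_iff)
    from eval_gword_pres_eq[OF s R this] show ?thesis
      by (simp add: \<phi>_def)
  qed
  show "\<phi> \<in> hom (presented_group R) G"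
    by (rule homI)
      (auto simp: carrier_presented_group \<phi> mult_presented_group
        eval_gword_closed[OF s] eval_gword_append[OF s])
qed

section \<open>Cyclic normal forms modulo the centre\<close>

primrec syllables :: "('g, 'm) monoid_scheme \<Rightarrow> 'g \<Rightarrow> 'g \<Rightarrow> nat list \<Rightarrow> 'g" where
  "syllables G a b [] = \<one>\<^bsub>G\<^esub>"
| "syllables G a b (e # es) = a \<otimes>\<^bsub>G\<^esub> (b [^]\<^bsub>G\<^esub> e \<otimes>\<^bsub>G\<^esub> syllables G a b es)"

lemma (in group) syllables_closed [simp]:
  "a \<in> carrier G \<Longrightarrow> b \<in> carrier G \<Longrightarrow> syllables G a b es \<in> carrier G"
  by (induction es) auto

lemma (in group) syllables_append:
  "a \<in> carrier G \<Longrightarrow> b \<in> carrier G \<Longrightarrow>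
    syllables G a b (es @ ds) = syllables G a b es \<otimes> syllables G a b ds"
  by (induction es) (auto simp: m_assoc)

lemma (in group_hom) hom_syllables:
  "a \<in> carrier G \<Longrightarrow> b \<in> carrier G \<Longrightarrow>
    h (syllables G a b es) = syllables H (h a) (h b) es"
  by (induction es) (auto simp: hom_nat_pow)

locale square_eq_cube = group G for G (structure) +
  fixes a b
  assumes a [simp]: "a \<in> carrier G" and b [simp]: "b \<in> carrier G"
    and rel: "a \<otimes> a = b \<otimes> (b \<otimes> b)"
    and gen: "carrier G = generate G {a, b}"
begin

definition Z where "Z = range (\<lambda>k::int. (a \<otimes> a) [^] k)"

lemma subgroup_Z: "subgroup Z G"
proof
  fix x y assume "x \<in> Z" "y \<in> Z"
  then obtain k l :: int where "x = (a \<otimes> a) [^] k" "y = (a \<otimes> a) [^] l"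
    by (auto simp: Z_def)
  then show "x \<otimes> y \<in> Z" by (auto simp: Z_def int_pow_mult[symmetric])
next
  have "(a \<otimes> a) [^] (0::int) = \<one>" by simp
  then show "\<one> \<in> Z" unfolding Z_def by (metis rangeI)
next
  fix x assume "x \<in> Z"
  then obtain k :: int where "x = (a \<otimes> a) [^] k" by (auto simp: Z_def)
  then show "inv x \<in> Z" by (auto simp: Z_def int_pow_neg[symmetric])
qed (auto simp: Z_def)

lemmas Z_closed [simp] = subgroup.mem_carrier[OF subgroup_Z]
lemmas Z_mult [simp] = subgroup.m_closed[OF subgroup_Z]
lemmas Z_inv [simp] = subgroup.m_inv_closed[OF subgroup_Z]
lemmas Z_one [simp] = subgroup.one_closed[OF subgroup_Z]

lemma aa_Z [simp]: "a \<otimes> a \<in> Z"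
proof -
  have "(a \<otimes> a) [^] (1::int) = a \<otimes> a" by (simp add: int_pow_1)
  then show ?thesis unfolding Z_def by (metis rangeI)
qed

lemma centralizer_subgroup:
  assumes x: "x \<in> carrier G"
  shows "subgroup {y \<in> carrier G. y \<otimes> x = x \<otimes> y} G"
proof
  fix y y' assume "y \<in> {y \<in> carrier G. y \<otimes> x = x \<otimes> y}" "y' \<in> {y \<in> carrier G. y \<otimes> x = x \<otimes> y}"
  then show "y \<otimes> y' \<in> {y \<in> carrier G. y \<otimes> x = x \<otimes> y}"
    using x by simp (metis m_assoc)
next
  fix y assume "y \<in> {y \<in> carrier G. y \<otimes> x = x \<otimes> y}"
  then have y: "y \<in> carrier G" "y \<otimes> x = x \<otimes> y" by auto
  have "inv y \<otimes> x = inv y \<otimes> (x \<otimes> y) \<otimes> inv y"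
    using x y(1) by (simp add: m_assoc)
  also have "\<dots> = x \<otimes> inv y"
    using x y(1) by (simp add: y(2)[symmetric] m_assoc[symmetric])
  finally show "inv y \<in> {y \<in> carrier G. y \<otimes> x = x \<otimes> y}"
    using y by simp
qed (use x in auto)

lemma Z_central:
  assumes c: "c \<in> Z" and x: "x \<in> carrier G"
  shows "x \<otimes> c = c \<otimes> x"
proof -
  have "b \<otimes> (a \<otimes> a) = (a \<otimes> a) \<otimes> b"
    by (simp add: rel m_assoc)
  then have "{a, b} \<subseteq> {y \<in> carrier G. y \<otimes> (a \<otimes> a) = (a \<otimes> a) \<otimes> y}"
    by (simp add: m_assoc)
  then have "generate G {a, b} \<subseteq> {y \<in> carrier G. y \<otimes> (a \<otimes> a) = (a \<otimes> a) \<otimes> y}"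
    by (rule generate_subgroup_incl) (simp add: centralizer_subgroup)
  then have "x \<in> {y \<in> carrier G. y \<otimes> (a \<otimes> a) = (a \<otimes> a) \<otimes> y}"
    using x unfolding gen by (rule subsetD)
  then have "a \<otimes> a \<in> {y \<in> carrier G. y \<otimes> x = x \<otimes> y}" by simp
  then have "c \<in> {y \<in> carrier G. y \<otimes> x = x \<otimes> y}"
    using c subgroup_int_pow_closed[OF centralizer_subgroup[OF x]] by (auto simp: Z_def)
  then show ?thesis by simp
qed

lemma Z_left_commute:
  assumes "c \<in> Z" "x \<in> carrier G" "y \<in> carrier G"
  shows "x \<otimes> (c \<otimes> y) = c \<otimes> (x \<otimes> y)"
  using Z_central[OF assms(1,2)] assms by (metis Z_closed m_assoc)

abbreviation w where "w es \<equiv> syllables G a b es"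

lemma b3: "b [^] (3::nat) = a \<otimes> a"
  by (simp add: numeral_3_eq_3 m_assoc rel)

definition normal_forms where
  "normal_forms = {c \<otimes> (b [^] i \<otimes> (w es \<otimes> a [^] j)) |c i es j.
    c \<in> Z \<and> i < (3::nat) \<and> set es \<subseteq> {1, 2} \<and> j < (2::nat)}"

lemma normal_formsI:
  "c \<in> Z \<Longrightarrow> i < (3::nat) \<Longrightarrow> set es \<subseteq> {1, 2} \<Longrightarrow> j < (2::nat) \<Longrightarrow>
    c \<otimes> (b [^] i \<otimes> (w es \<otimes> a [^] j)) \<in> normal_forms"
  unfolding normal_forms_def by blast

lemma normal_forms_closed: "x \<in> normal_forms \<Longrightarrow> x \<in> carrier G"
  by (auto simp: normal_forms_def)

lemma normal_forms_Z:
  assumes "d \<in> Z" "x \<in> normal_forms" shows "d \<otimes> x \<in> normal_forms"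
proof -
  from assms(2) obtain c i es j where
    x: "x = c \<otimes> (b [^] i \<otimes> (w es \<otimes> a [^] j))" "c \<in> Z" "i < (3::nat)" "set es \<subseteq> {1, 2}" "j < (2::nat)"
    by (auto simp: normal_forms_def)
  then have "d \<otimes> x = (d \<otimes> c) \<otimes> (b [^] i \<otimes> (w es \<otimes> a [^] j))"
    using assms(1) by (simp add: m_assoc)
  then show ?thesis using x assms(1) by (simp only:) (intro normal_formsI, auto)
qed

lemma normal_forms_b:
  assumes "x \<in> normal_forms" shows "b \<otimes> x \<in> normal_forms"
proof -
  from assms obtain c i es j where
    x: "x = c \<otimes> (b [^] i \<otimes> (w es \<otimes> a [^] j))" and c: "c \<in> Z" and i: "i < (3::nat)"
    and es: "set es \<subseteq> {1, 2}" and j: "j < (2::nat)"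
    by (auto simp: normal_forms_def)
  let ?y = "w es \<otimes> a [^] j"
  have "b \<otimes> x = c \<otimes> (b \<otimes> (b [^] i \<otimes> ?y))"
    using c by (simp add: x Z_left_commute[OF c b])
  also have "b \<otimes> (b [^] i \<otimes> ?y) = b [^] Suc i \<otimes> ?y"
    by (simp only: nat_pow_Suc2[OF b]) (simp add: m_assoc)
  finally have bx: "b \<otimes> x = c \<otimes> (b [^] Suc i \<otimes> ?y)" .
  show ?thesis
  proof (cases "i = 2")
    case True
    have "b \<otimes> x = c \<otimes> ((a \<otimes> a) \<otimes> ?y)"
      using b3 by (simp only: bx True) (simp add: numeral_3_eq_3 numeral_2_eq_2)
    also have "\<dots> = (c \<otimes> (a \<otimes> a)) \<otimes> (b [^] (0::nat) \<otimes> ?y)"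
      using c by (simp add: m_assoc)
    finally show ?thesis using c es j by (simp only:) (intro normal_formsI, auto)
  next
    case False
    then show ?thesis unfolding bx using c es j i by (intro normal_formsI) auto
  qed
qed

lemma normal_forms_a:
  assumes "x \<in> normal_forms" shows "a \<otimes> x \<in> normal_forms"
proof -
  from assms obtain c i es j where
    x: "x = c \<otimes> (b [^] i \<otimes> (w es \<otimes> a [^] j))" and c: "c \<in> Z" and i: "i < (3::nat)"
    and es: "set es \<subseteq> {1, 2}" and j: "j < (2::nat)"
    by (auto simp: normal_forms_def)
  have ax: "a \<otimes> x = c \<otimes> (a \<otimes> (b [^] i \<otimes> (w es \<otimes> a [^] j)))"
    using c by (simp add: x Z_left_commute[OF c a])
  consider "i \<noteq> 0" | "i = 0" "es = []" "j = 0" | "i = 0" "es = []" "j = 1"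
    | e ds where "i = 0" "es = e # ds"
    using less_2_cases[OF j] by (cases es) auto
  then show ?thesis
  proof cases
    case 1
    have "a \<otimes> x = c \<otimes> (b [^] (0::nat) \<otimes> (w (i # es) \<otimes> a [^] j))"
      using c by (simp add: ax m_assoc)
    then show ?thesis using c es j i 1 by (simp only:) (intro normal_formsI, auto)
  next
    case 2
    have "a \<otimes> x = c \<otimes> (b [^] (0::nat) \<otimes> (w [] \<otimes> a [^] (1::nat)))"
      using c 2 by (simp add: ax)
    then show ?thesis using c by (simp only:) (intro normal_formsI, auto)
  next
    case 3
    have "a \<otimes> x = (c \<otimes> (a \<otimes> a)) \<otimes> (b [^] (0::nat) \<otimes> (w [] \<otimes> a [^] (0::nat)))"
      using c 3 by (simp add: ax)
    then show ?thesis using c by (simp only:) (intro normal_formsI, auto)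
  next
    case 4
    have "a \<otimes> x = (c \<otimes> (a \<otimes> a)) \<otimes> (b [^] e \<otimes> (w ds \<otimes> a [^] j))"
      using c 4 by (simp add: ax m_assoc)
    then show ?thesis using c es j 4 by (simp only:) (intro normal_formsI, auto)
  qed
qed

lemma carrier_normal_forms: "x \<in> carrier G \<Longrightarrow> x \<in> normal_forms"
proof -
  have "\<forall>y \<in> normal_forms. x \<otimes> y \<in> normal_forms" if "x \<in> generate G {a, b}" for x
    using that
  proof induction
    case one
    then show ?case by (simp add: normal_forms_closed)
  next
    case (incl h)
    then show ?case using normal_forms_a normal_forms_b by auto
  next
    case (inv h)
    show ?case
    proof
      fix y assume y: "y \<in> normal_forms"
      have "inv a = inv (a \<otimes> a) \<otimes> a"
        by (rule inv_equality) (simp_all add: m_assoc del: inv_mult_group)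
      moreover have "inv b = inv (a \<otimes> a) \<otimes> (b \<otimes> b)"
        by (rule inv_equality) (simp_all add: m_assoc rel[symmetric])
      ultimately have "inv h \<otimes> y = inv (a \<otimes> a) \<otimes> (a \<otimes> y) \<or>
          inv h \<otimes> y = inv (a \<otimes> a) \<otimes> (b \<otimes> (b \<otimes> y))"
        using inv y by (auto simp: normal_forms_closed m_assoc)
      then show "inv h \<otimes> y \<in> normal_forms"
        using normal_forms_Z[OF Z_inv[OF aa_Z] normal_forms_a[OF y]]
          normal_forms_Z[OF Z_inv[OF aa_Z] normal_forms_b[OF normal_forms_b[OF y]]] by metis
    qed
  next
    case (eng h1 h2)
    have "h1 \<in> carrier G" "h2 \<in> carrier G" using eng gen by auto
    then show ?case using eng by (auto simp: m_assoc normal_forms_closed)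
  qed
  moreover have "\<one> \<in> normal_forms"
    using normal_formsI[of \<one> 0 "[]" 0] by simp
  ultimately show "x \<in> carrier G \<Longrightarrow> x \<in> normal_forms"
    using gen by (metis r_one)
qed

definition conj_mod_Z where
  "conj_mod_Z g h \<longleftrightarrow> (\<exists>c\<in>Z. \<exists>x\<in>carrier G. h = c \<otimes> (x \<otimes> g \<otimes> inv x))"

lemma conj_mod_Z_comm:
  assumes "u \<in> carrier G" "v \<in> carrier G"
  shows "conj_mod_Z (u \<otimes> v) (v \<otimes> u)"
  unfolding conj_mod_Z_def using assms
  by (intro bexI[of _ \<one>] bexI[of _ v]) (auto simp: m_assoc)

lemma conj_mod_Z_mult:
  assumes "c \<in> Z" "g \<in> carrier G"
  shows "conj_mod_Z (c \<otimes> g) g"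
  unfolding conj_mod_Z_def using assms
  by (intro bexI[of _ "inv c"] bexI[of _ \<one>]) (auto simp: m_assoc[symmetric])

lemma conj_mod_Z_sym:
  assumes "conj_mod_Z g h" "g \<in> carrier G"
  shows "conj_mod_Z h g"
proof -
  from assms obtain c x where c: "c \<in> Z" and x: "x \<in> carrier G" and h: "h = c \<otimes> (x \<otimes> g \<otimes> inv x)"
    by (auto simp: conj_mod_Z_def)
  have "inv c \<otimes> (inv x \<otimes> h \<otimes> inv (inv x)) = (inv c \<otimes> (inv x \<otimes> h)) \<otimes> x"
    using c x assms(2) by (simp add: h m_assoc)
  also have "inv c \<otimes> (inv x \<otimes> h) = inv x \<otimes> (inv c \<otimes> h)"
    using c x assms(2) by (intro Z_left_commute[symmetric]) (auto simp: h)
  also have "inv c \<otimes> h = x \<otimes> g \<otimes> inv x"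
    using c x assms(2) by (simp add: h m_assoc[symmetric])
  also have "inv x \<otimes> (x \<otimes> g \<otimes> inv x) \<otimes> x = (inv x \<otimes> x) \<otimes> g \<otimes> (inv x \<otimes> x)"
    using x assms(2) by (simp only: m_assoc m_closed inv_closed)
  also have "\<dots> = g"
    using x assms(2) by simp
  finally show ?thesis
    unfolding conj_mod_Z_def using c x by (intro bexI[of _ "inv c"] bexI[of _ "inv x"]) auto
qed

lemma conj_mod_Z_trans:
  assumes "conj_mod_Z g h" "conj_mod_Z h k" "g \<in> carrier G"
  shows "conj_mod_Z g k"
proof -
  from assms obtain c x d y where c: "c \<in> Z" "d \<in> Z" and x: "x \<in> carrier G" "y \<in> carrier G"
    and h: "h = c \<otimes> (x \<otimes> g \<otimes> inv x)" and k: "k = d \<otimes> (y \<otimes> h \<otimes> inv y)"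
    by (auto simp: conj_mod_Z_def)
  have "k = (d \<otimes> c) \<otimes> ((y \<otimes> x) \<otimes> g \<otimes> inv (y \<otimes> x))"
    using c x assms(3) by (simp add: h k m_assoc Z_left_commute inv_mult_group)
  then show ?thesis
    unfolding conj_mod_Z_def using c x by (intro bexI[of _ "d \<otimes> c"] bexI[of _ "y \<otimes> x"]) auto
qed

lemma conj_mod_Z_rotate: "conj_mod_Z (w es) (w (rotate n es))"
  using conj_mod_Z_comm[of "w (take (n mod length es) es)" "w (drop (n mod length es) es)"]
  by (simp add: rotate_drop_take syllables_append[symmetric])

definition cyclic_forms where
  "cyclic_forms = {a, b, b [^] (2::nat)} \<union> w ` {es. set es \<subseteq> {1, 2}}"

lemma cyclic_formsI: "set es \<subseteq> {1, 2} \<Longrightarrow> w es \<in> cyclic_forms"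
  by (auto simp: cyclic_forms_def)

lemma cyclic_forms_closed: "x \<in> cyclic_forms \<Longrightarrow> x \<in> carrier G"
  by (auto simp: cyclic_forms_def)

lemma normal_form_conj_cyclic_form:
  assumes "i < 3" "j < 2" "set es \<subseteq> {1, 2}"
  shows "\<exists>t\<in>cyclic_forms. conj_mod_Z (b [^] (i::nat) \<otimes> (w es \<otimes> a [^] (j::nat))) t"
  using assms
proof (induction "length es" arbitrary: es i j rule: less_induct)
  case less
  have refl: "conj_mod_Z t t" if "t \<in> carrier G" for t
    using conj_mod_Z_mult[of \<one> t] that by simp
  consider "i \<noteq> 0" "j = 1" | "i = 0" "j = 1" "es = []"
    | e ds where "i = 0" "j = 1" "es = e # ds" | "i = 0" "j = 0"
    | "i \<noteq> 0" "j = 0" "es = []" | e ds where "i \<noteq> 0" "j = 0" "es = ds @ [e]"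
    using less_2_cases[OF less.prems(2)]
    by (metis One_nat_def list.exhaust rev_exhaust)
  then show ?case
  proof cases
    case 1
    have "conj_mod_Z (b [^] i \<otimes> (w es \<otimes> a [^] j)) (w (es @ [i]))"
      using conj_mod_Z_comm[of "b [^] i" "w es \<otimes> a"] 1 by (simp add: syllables_append m_assoc)
    moreover have "w (es @ [i]) \<in> cyclic_forms"
      using less.prems 1 by (intro cyclic_formsI) auto
    ultimately show ?thesis by blast
  next
    case 2
    then show ?thesis using refl[of a] by (auto simp: cyclic_forms_def)
  next
    case 3
    obtain t where t: "t \<in> cyclic_forms" "conj_mod_Z (b [^] e \<otimes> (w ds \<otimes> a [^] (0::nat))) t"
      using less.hyps[of ds e 0] less.prems 3 by auto
    have "conj_mod_Z (w es \<otimes> a) (a \<otimes> w es)"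
      by (rule conj_mod_Z_comm) auto
    moreover have "a \<otimes> w es = (a \<otimes> a) \<otimes> (b [^] e \<otimes> w ds)"
      by (simp add: 3 m_assoc)
    moreover have "conj_mod_Z \<dots> (b [^] e \<otimes> w ds)"
      by (rule conj_mod_Z_mult) auto
    ultimately have "conj_mod_Z (w es \<otimes> a) (b [^] e \<otimes> w ds)"
      using conj_mod_Z_trans by (metis a b m_closed syllables_closed)
    then have "conj_mod_Z (w es \<otimes> a) t"
      using t conj_mod_Z_trans by (metis a b m_closed syllables_closed nat_pow_0 r_one)
    then show ?thesis using t 3 by auto
  next
    case 4
    then show ?thesis using refl[of "w es"] less.prems cyclic_formsI[of es] by auto
  next
    case 5
    moreover have "i = 1 \<or> i = 2" using less.prems 5 by auto
    ultimately show ?thesis using refl[of "b [^] i"] by (auto simp: cyclic_forms_def)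
  next
    case 6
    have "conj_mod_Z (b [^] i \<otimes> w es) (w es \<otimes> b [^] i)"
      by (rule conj_mod_Z_comm) auto
    also have wb: "w es \<otimes> b [^] i = w ds \<otimes> (a \<otimes> b [^] (e + i))"
      by (simp add: 6 syllables_append m_assoc nat_pow_mult)
    finally have *: "conj_mod_Z (b [^] i \<otimes> w es) (w ds \<otimes> (a \<otimes> b [^] (e + i)))" .
    have "i \<in> {1, 2}" "e \<in> {1, 2}" using less.prems 6 by auto
    then consider "e + i = 2" | "e + i = 3" | "e + i = 4" by auto
    then show ?thesis
    proof cases
      case 1
      have "w ds \<otimes> (a \<otimes> b [^] (e + i)) = w (ds @ [2])"
        by (simp add: 1 syllables_append)
      moreover have "w (ds @ [2]) \<in> cyclic_forms"
        using less.prems 6 by (intro cyclic_formsI) auto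
      ultimately show ?thesis using * 6 by auto
    next
      case 2
      obtain t where t: "t \<in> cyclic_forms" "conj_mod_Z (b [^] (0::nat) \<otimes> (w ds \<otimes> a [^] (1::nat))) t"
        using less.hyps[of ds 0 1] less.prems 6 by auto
      have "w ds \<otimes> (a \<otimes> b [^] (e + i)) = (a \<otimes> a) \<otimes> (w ds \<otimes> a)"
        by (simp add: 2 b3 Z_left_commute Z_central[OF aa_Z])
      then have "conj_mod_Z (b [^] i \<otimes> w es) (w ds \<otimes> a)"
        using * conj_mod_Z_mult[of "a \<otimes> a" "w ds \<otimes> a"] conj_mod_Z_trans by auto
      then have "conj_mod_Z (b [^] i \<otimes> w es) t"
        using t conj_mod_Z_trans by auto
      then show ?thesis using t 6 by auto
    next
      case 3
      have "b [^] (e + i) = b [^] (3 + 1 :: nat)" by (simp add: 3)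
      also have "\<dots> = (a \<otimes> a) \<otimes> b [^] (1::nat)"
        by (simp only: nat_pow_mult[symmetric, OF b] b3)
      finally have "w ds \<otimes> (a \<otimes> b [^] (e + i)) = w ds \<otimes> (a \<otimes> ((a \<otimes> a) \<otimes> b [^] (1::nat)))"
        by simp
      also have "\<dots> = (a \<otimes> a) \<otimes> w (ds @ [1])"
        using Z_left_commute[OF aa_Z, of a "b [^] (1::nat)"]
          Z_left_commute[OF aa_Z, of "w ds" "a \<otimes> b [^] (1::nat)"] by (simp add: syllables_append)
      finally have "conj_mod_Z (b [^] i \<otimes> w es) (w (ds @ [1]))"
        using * conj_mod_Z_mult[of "a \<otimes> a" "w (ds @ [1])"] conj_mod_Z_trans by auto
      moreover have "w (ds @ [1]) \<in> cyclic_forms"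
        using less.prems 6 by (intro cyclic_formsI) auto
      ultimately show ?thesis using 6 by auto
    qed
  qed
qed

lemma conj_cyclic_form:
  assumes "g \<in> carrier G"
  obtains t where "t \<in> cyclic_forms" "conj_mod_Z g t"
proof -
  from carrier_normal_forms[OF assms] obtain c i es j where
    g: "g = c \<otimes> (b [^] i \<otimes> (w es \<otimes> a [^] j))" "c \<in> Z" "i < (3::nat)" "set es \<subseteq> {1, 2}" "j < (2::nat)"
    by (auto simp: normal_forms_def)
  obtain t where "t \<in> cyclic_forms" "conj_mod_Z (b [^] i \<otimes> (w es \<otimes> a [^] j)) t"
    using normal_form_conj_cyclic_form g by blast
  moreover have "conj_mod_Z g (b [^] i \<otimes> (w es \<otimes> a [^] j))"
    using g by (simp add: conj_mod_Z_mult)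
  ultimately show ?thesis using that conj_mod_Z_trans assms by blast
qed

lemma hom_conj_mod_Z:
  assumes \<phi>: "\<phi> \<in> hom G H" "group H" and aa: "\<phi> a \<otimes>\<^bsub>H\<^esub> \<phi> a = \<one>\<^bsub>H\<^esub>"
    and g: "g \<in> carrier G" and "conj_mod_Z g h"
  shows "conjugate_in H (\<phi> g) (\<phi> h)"
proof -
  interpret group_hom G H \<phi>
    using \<phi> by (simp add: group_hom_def group_hom_axioms_def)
  from assms(5) obtain c x where c: "c \<in> Z" and x: "x \<in> carrier G"
    and h: "h = c \<otimes> (x \<otimes> g \<otimes> inv x)"
    by (auto simp: conj_mod_Z_def)
  from c obtain k :: int where k: "c = (a \<otimes> a) [^] k" by (auto simp: Z_def)
  have "\<phi> c = \<one>\<^bsub>H\<^esub>"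
    unfolding k using aa by (subst hom_int_pow) auto
  then show ?thesis
    unfolding conjugate_in_def using x g c by (intro bexI[of _ "\<phi> x"]) (auto simp: h)
qed

lemma integer_hom_conj_mod_Z:
  assumes e: "e \<in> hom G integer_group" and g: "g \<in> carrier G" and "conj_mod_Z g h"
  obtains k where "e h = e g + 2 * k * e a" "k = 0 \<Longrightarrow> conjugate_in G g h"
proof -
  interpret e: group_hom G integer_group e
    using e by (simp add: group_hom_def group_hom_axioms_def)
  from assms(3) obtain c x where c: "c \<in> Z" and x: "x \<in> carrier G"
    and h: "h = c \<otimes> (x \<otimes> g \<otimes> inv x)"
    by (auto simp: conj_mod_Z_def)
  from c obtain k :: int where k: "c = (a \<otimes> a) [^] k" by (auto simp: Z_def)
  have "e c = k * (2 * e a)"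
    unfolding k by (subst e.hom_int_pow) auto
  then have "e h = e g + 2 * k * e a"
    using x g c by (simp add: h)
  moreover have "conjugate_in G g h" if "k = 0"
    unfolding conjugate_in_def using x g that by (intro bexI[of _ x]) (auto simp: h k)
  ultimately show ?thesis by (rule that)
qed

end

section \<open>The action on a ring of triangles\<close>

locale cyclic_word_action =
  fixes es :: "nat list"
  assumes nonempty: "es \<noteq> []" and es_12: "set es \<subseteq> {1, 2}"
begin

definition n :: int where "n = int (length es)"

text \<open>The point \<open>(i, j)\<close> is the vertex \<open>j\<close> of the triangle \<open>i\<close>; the entry vertex is \<open>0\<close> and the exit
  vertex is \<open>\<epsilon> i\<close>.\<close>

definition \<epsilon> :: "int \<Rightarrow> nat" where "\<epsilon> i = es ! nat (i mod n)"

definition X :: "(int \<times> nat) set" where "X = {0..<3 * n} \<times> {0..<3}"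

definition B :: "int \<times> nat \<Rightarrow> int \<times> nat" where
  "B p = (if p \<in> X then (fst p, (snd p + 1) mod 3) else p)"

definition A :: "int \<times> nat \<Rightarrow> int \<times> nat" where
  "A p = (if p \<in> X then
      if snd p = \<epsilon> (fst p) then ((fst p - 1) mod (3 * n), 0)
      else if snd p = 0 then ((fst p + 1) mod (3 * n), \<epsilon> (fst p + 1))
      else p
    else p)"

definition \<tau> :: "int \<times> nat \<Rightarrow> int \<times> nat" where
  "\<tau> p = (if p \<in> X then ((fst p - n) mod (3 * n), snd p) else p)"

definition H :: "(int \<times> nat \<Rightarrow> int \<times> nat) monoid" where
  "H = \<lparr>carrier = {f. f permutes X \<and> f \<circ> \<tau> = \<tau> \<circ> f}, monoid.mult = (\<circ>), one = id\<rparr>"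

definition shifts_a_point where "shifts_a_point f \<longleftrightarrow> (\<exists>p\<in>X. f p = \<tau> p)"

lemma n_pos: "n > 0"
  using nonempty by (simp add: n_def)

lemma X_iff: "(i, j) \<in> X \<longleftrightarrow> 0 \<le> i \<and> i < 3 * n \<and> j < 3"
  by (auto simp: X_def)

lemma mod_in_X [simp]: "(k mod (3 * n), j) \<in> X \<longleftrightarrow> j < 3"
  using n_pos by (simp add: X_iff)

lemma \<epsilon>_mod [simp]: "\<epsilon> (k mod (3 * n)) = \<epsilon> k"
  by (simp add: \<epsilon>_def mod_mod_cancel)

lemma \<epsilon>_diff [simp]: "\<epsilon> (k - n) = \<epsilon> k"
  by (simp add: \<epsilon>_def)

lemma \<epsilon>_12: "\<epsilon> k = 1 \<or> \<epsilon> k = 2"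
proof -
  have "nat (k mod n) < length es"
    using n_pos by (simp add: n_def nat_less_iff)
  then have "\<epsilon> k \<in> set es" by (simp add: \<epsilon>_def)
  then show ?thesis using es_12 by auto
qed

lemma \<epsilon>_bounds [simp]: "\<epsilon> k < 3" "\<epsilon> k \<noteq> 0" "0 \<noteq> \<epsilon> k"
  using \<epsilon>_12[of k] by auto

lemma \<epsilon>_mod_Suc [simp]: "\<epsilon> (k mod (3 * n) + 1) = \<epsilon> (k + 1)"
  using \<epsilon>_mod[of "k mod (3 * n) + 1"] \<epsilon>_mod[of "k + 1"] by (simp only: mod_add_left_eq)

lemma A_\<epsilon>: "A (k mod (3 * n), \<epsilon> k) = ((k - 1) mod (3 * n), 0)"
  by (simp add: A_def mod_diff_left_eq)

lemma A_0: "A (k mod (3 * n), 0) = ((k + 1) mod (3 * n), \<epsilon> (k + 1))"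
  by (simp add: A_def mod_add_left_eq)

lemma A_spare: "j \<noteq> \<epsilon> k \<Longrightarrow> j \<noteq> 0 \<Longrightarrow> A (k mod (3 * n), j) = (k mod (3 * n), j)"
  by (simp add: A_def)

lemma \<tau>_X: "j < 3 \<Longrightarrow> \<tau> (k mod (3 * n), j) = ((k - n) mod (3 * n), j)"
  by (simp add: \<tau>_def mod_diff_left_eq)

lemma X_cases:
  assumes "p \<in> X"
  obtains (exit) k where "p = (k mod (3 * n), \<epsilon> k)"
  | (entry) k where "p = (k mod (3 * n), 0)"
  | (spare) k j where "p = (k mod (3 * n), j)" "j < 3" "j \<noteq> \<epsilon> k" "j \<noteq> 0"
proof -
  have "p = (fst p mod (3 * n), snd p)" "snd p < 3"
    using assms by (auto simp: X_def)
  then show ?thesis using exit entry spare by metis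
qed

lemma AA [simp]: "A (A p) = p"
proof (cases "p \<in> X")
  case True
  then show ?thesis
  proof (cases rule: X_cases)
    case (exit k)
    then show ?thesis using A_0[of "k - 1"] by (simp add: A_\<epsilon>)
  next
    case (entry k)
    then show ?thesis using A_\<epsilon>[of "k + 1"] by (simp add: A_0)
  qed (simp add: A_spare)
qed (simp add: A_def)

lemma BBB [simp]: "B (B (B p)) = p"
proof (cases "p \<in> X")
  case True
  then show ?thesis
    by (cases p) (auto simp: B_def X_iff mod_simps)
qed (simp add: B_def)

lemma A_permutes: "A permutes X"
proof -
  have "A p = p" if "p \<notin> X" for p using that by (simp add: A_def)
  then show ?thesis unfolding permutes_def by (metis AA)
qed

lemma B_permutes: "B permutes X"
proof -
  have "B p = p" if "p \<notin> X" for p using that by (simp add: B_def)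
  then show ?thesis unfolding permutes_def by (metis BBB)
qed

lemma A_\<tau>: "A \<circ> \<tau> = \<tau> \<circ> A"
proof
  fix p
  show "(A \<circ> \<tau>) p = (\<tau> \<circ> A) p"
  proof (cases "p \<in> X")
    case True
    then show ?thesis
    proof (cases rule: X_cases)
      case (exit k)
      then show ?thesis using A_\<epsilon>[of "k - n"]
        by (simp add: A_\<epsilon> \<tau>_X) (simp add: algebra_simps)
    next
      case (entry k)
      have "k - n + 1 = (k + 1) - n" by simp
      then show ?thesis using A_0[of "k - n"] entry
        by (simp only: o_apply A_0 \<tau>_X \<epsilon>_bounds \<epsilon>_diff)
    next
      case (spare k j)
      then show ?thesis by (simp add: A_spare \<tau>_X)
    qed
  qed (simp add: A_def \<tau>_def)
qed

lemma fst_\<tau>_neq: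
  assumes "p \<in> X" shows "fst (\<tau> p) \<noteq> fst p"
proof
  assume "fst (\<tau> p) = fst p"
  then have "(fst p - n) mod (3 * n) = fst p mod (3 * n)"
    using assms by (simp add: \<tau>_def) (metis mod_mod_trivial)
  then have "3 * n dvd n"
    by (simp add: mod_eq_dvd_iff)
  then show False using n_pos by (auto dest: zdvd_imp_le)
qed

lemma B_\<tau>: "B \<circ> \<tau> = \<tau> \<circ> B"
proof
  fix p
  show "(B \<circ> \<tau>) p = (\<tau> \<circ> B) p"
    by (cases p) (auto simp: B_def \<tau>_def X_iff)
qed

lemma H_simps [simp]: "monoid.mult H = (\<circ>)" "one H = id"
  by (simp_all add: H_def)

lemma carrier_H: "f \<in> carrier H \<longleftrightarrow> f permutes X \<and> f \<circ> \<tau> = \<tau> \<circ> f"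
  by (simp add: H_def)

lemma A_H [simp]: "A \<in> carrier H" and B_H [simp]: "B \<in> carrier H"
  by (simp_all add: carrier_H A_permutes B_permutes A_\<tau> B_\<tau>)

lemma group_H: "group H"
proof (rule groupI)
  fix f g assume "f \<in> carrier H" "g \<in> carrier H"
  then show "f \<otimes>\<^bsub>H\<^esub> g \<in> carrier H"
    unfolding carrier_H by (auto simp: permutes_compose) (metis comp_assoc)
next
  fix f assume f: "f \<in> carrier H"
  then have perm: "f permutes X" by (simp add: carrier_H)
  have "inv_into UNIV f (\<tau> p) = \<tau> (inv_into UNIV f p)" for p
  proof -
    have "f (\<tau> (inv_into UNIV f p)) = \<tau> (f (inv_into UNIV f p))"
      using f by (metis carrier_H comp_apply)
    then show ?thesis using perm by (metis permutes_inverses)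
  qed
  then have "inv_into UNIV f \<in> carrier H"
    using perm by (auto simp: carrier_H permutes_inv fun_eq_iff)
  moreover have "inv_into UNIV f \<otimes>\<^bsub>H\<^esub> f = \<one>\<^bsub>H\<^esub>"
    using perm by (simp add: permutes_inv_o)
  ultimately show "\<exists>g\<in>carrier H. g \<otimes>\<^bsub>H\<^esub> f = \<one>\<^bsub>H\<^esub>" by blast
qed (auto simp: carrier_H comp_assoc)

lemma finite_H: "finite (carrier H)"
proof -
  have "finite {f. f permutes X}"
    by (rule finite_permutations) (simp add: X_def)
  then show ?thesis by (rule rev_finite_subset) (auto simp: carrier_H)
qed

lemma shifts_a_point_conjugate:
  assumes "conjugate_in H f g" "f \<in> carrier H" "shifts_a_point f"
  shows "shifts_a_point g"
proof -
  interpret group H by (rule group_H)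
  from assms obtain x p where x: "x \<in> carrier H" and g: "g = x \<circ> f \<circ> inv\<^bsub>H\<^esub> x"
    and p: "p \<in> X" "f p = \<tau> p"
    by (auto simp: conjugate_in_def shifts_a_point_def)
  have "(inv\<^bsub>H\<^esub> x) (x p) = p"
    using fun_cong[OF l_inv[OF x], of p] by simp
  moreover have "x (\<tau> p) = \<tau> (x p)"
    using x by (metis carrier_H comp_apply)
  ultimately have "g (x p) = \<tau> (x p)"
    using p by (simp add: g)
  moreover have "x p \<in> X"
    using x p by (simp add: carrier_H permutes_in_image)
  ultimately show ?thesis by (auto simp: shifts_a_point_def)
qed

lemma B_pow: "(i, j) \<in> X \<Longrightarrow> (B [^]\<^bsub>H\<^esub> d) (i, j) = (i, (j + d) mod 3)"
proof -
  interpret group H by (rule group_H)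
  assume "(i, j) \<in> X"
  then show ?thesis
  proof (induction d)
    case (Suc d)
    have "B [^]\<^bsub>H\<^esub> Suc d = B \<circ> B [^]\<^bsub>H\<^esub> d"
      using nat_pow_Suc2[OF B_H] by simp
    moreover have "B (i, (j + d) mod 3) = (i, (j + Suc d) mod 3)"
      using Suc.prems by (simp add: B_def X_iff mod_simps)
    ultimately show ?case using Suc by (simp del: nat_pow_Suc)
  qed (simp add: X_iff)
qed

lemma syllables_H_Cons:
  "syllables H A B (d # ds) p = A ((B [^]\<^bsub>H\<^esub> d) (syllables H A B ds p))"
  by simp

lemma syllables_forward:
  assumes "\<And>t. t < length ds \<Longrightarrow> ds ! t = \<epsilon> (i - (int (length ds) - 1 - int t))"
  shows "syllables H A B ds (i mod (3 * n), 0) = ((i - int (length ds)) mod (3 * n), 0)"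
  using assms
proof (induction ds)
  case (Cons d ds)
  have "syllables H A B ds (i mod (3 * n), 0) = ((i - int (length ds)) mod (3 * n), 0)"
  proof (rule Cons.IH)
    fix t assume "t < length ds"
    then show "ds ! t = \<epsilon> (i - (int (length ds) - 1 - int t))"
      using Cons.prems[of "Suc t"] by (simp add: algebra_simps)
  qed
  moreover have "d = \<epsilon> (i - int (length ds))"
    using Cons.prems[of 0] by simp
  ultimately have "syllables H A B (d # ds) (i mod (3 * n), 0) =
      A ((i - int (length ds)) mod (3 * n), \<epsilon> (i - int (length ds)))"
    by (simp only: syllables_H_Cons) (simp add: B_pow)
  also have "\<dots> = ((i - int (length ds) - 1) mod (3 * n), 0)"
    by (rule A_\<epsilon>)
  also have "i - int (length ds) - 1 = i - int (length (d # ds))" by simp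
  finally show ?case .
qed simp

lemma shifts_a_point_syllables: "shifts_a_point (syllables H A B es)"
proof -
  have "syllables H A B es ((n - 1) mod (3 * n), 0) = ((n - 1 - int (length es)) mod (3 * n), 0)"
  proof (rule syllables_forward)
    fix t assume "t < length es"
    then show "es ! t = \<epsilon> (n - 1 - (int (length es) - 1 - int t))"
      by (simp add: \<epsilon>_def n_def nat_mod_as_int)
  qed
  also have "\<dots> = \<tau> ((n - 1) mod (3 * n), 0)"
    by (simp add: \<tau>_def n_def[symmetric] mod_simps)
  finally show ?thesis
    unfolding shifts_a_point_def by (intro bexI[of _ "((n - 1) mod (3 * n), 0)"]) auto
qed

lemma A_step:
  assumes "j < 3"
  obtains s j' where "A (k mod (3 * n), j) = ((k + s) mod (3 * n), j')" "j' < 3" "\<bar>s\<bar> \<le> 1"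
    "s = -1 \<Longrightarrow> j = \<epsilon> k \<and> j' = 0"
proof -
  consider "j = \<epsilon> k" | "j \<noteq> \<epsilon> k" "j = 0" | "j \<noteq> \<epsilon> k" "j \<noteq> 0" by blast
  then show ?thesis
  proof cases
    case 1
    then show ?thesis using that[of "-1" 0] A_\<epsilon>[of k] by simp
  next
    case 2
    then show ?thesis using that[of 1 "\<epsilon> (k + 1)"] A_0[of k] by simp
  next
    case 3
    then show ?thesis using that[of 0 j] assms by (simp add: A_def)
  qed
qed

lemma syllables_path:
  assumes "j < 3" "set ds \<subseteq> {1, 2}"
  obtains s j' where "syllables H A B ds (i mod (3 * n), j) = ((i + s) mod (3 * n), j')" "j' < 3"
    "\<bar>s\<bar> \<le> int (length ds)"
    "s = - int (length ds) \<longrightarrow> (ds \<noteq> [] \<longrightarrow> j' = 0) \<and> (j = 0 \<longrightarrow> j' = 0 \<and>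
      (\<forall>t<length ds. ds ! t = \<epsilon> (i - (int (length ds) - 1 - int t))))"
  using assms
proof (induction ds arbitrary: thesis)
  case Nil
  then show ?case using Nil.prems(1)[of 0 j] by simp
next
  case (Cons d ds)
  have d: "d \<in> {1, 2}" and ds: "set ds \<subseteq> {1, 2}" using Cons.prems by auto
  let ?m = "int (length ds)"
  obtain s j' where IH: "syllables H A B ds (i mod (3 * n), j) = ((i + s) mod (3 * n), j')" "j' < 3"
    "\<bar>s\<bar> \<le> ?m"
    "s = - ?m \<longrightarrow> (ds \<noteq> [] \<longrightarrow> j' = 0) \<and> (j = 0 \<longrightarrow> j' = 0 \<and>
      (\<forall>t<length ds. ds ! t = \<epsilon> (i - (?m - 1 - int t))))"
    using Cons.IH[OF _ \<open>j < 3\<close> ds] by blast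
  obtain r j'' where step: "A ((i + s) mod (3 * n), (j' + d) mod 3) = ((i + s + r) mod (3 * n), j'')"
    "j'' < 3" "\<bar>r\<bar> \<le> 1" "r = -1 \<Longrightarrow> (j' + d) mod 3 = \<epsilon> (i + s) \<and> j'' = 0"
    by (rule A_step[of "(j' + d) mod 3" "i + s"]) simp_all
  show ?case
  proof (rule Cons.prems(1)[of "s + r" j''])
    show "syllables H A B (d # ds) (i mod (3 * n), j) = ((i + (s + r)) mod (3 * n), j'')"
      using IH(1,2) step(1) by (simp add: syllables_H_Cons B_pow add.assoc del: syllables.simps)
    show "j'' < 3" by fact
    show "\<bar>s + r\<bar> \<le> int (length (d # ds))" using IH(3) step(3) by simp
    have "(d # ds \<noteq> [] \<longrightarrow> j'' = 0) \<and> (j = 0 \<longrightarrow> j'' = 0 \<and>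
      (\<forall>t<length (d # ds). (d # ds) ! t = \<epsilon> (i - (int (length (d # ds)) - 1 - int t))))"
      if "s + r = - int (length (d # ds))"
    proof -
      have sr: "s = - ?m" "r = -1" using that IH(3) step(3) by auto
      have "(d # ds) ! t = \<epsilon> (i - (int (length (d # ds)) - 1 - int t))"
        if "j = 0" "t < length (d # ds)" for t
      proof (cases t)
        case 0
        have "j' = 0" using IH(4) sr that by auto
        then show ?thesis using step(4) sr d 0 by auto
      next
        case (Suc u)
        then show ?thesis using IH(4) sr that by (auto simp: algebra_simps)
      qed
      then show ?thesis
        using step(4) sr by blast
    qed
    then show "s + r = - int (length (d # ds)) \<longrightarrow>
      (d # ds \<noteq> [] \<longrightarrow> j'' = 0) \<and> (j = 0 \<longrightarrow> j'' = 0 \<and>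
      (\<forall>t<length (d # ds). (d # ds) ! t = \<epsilon> (i - (int (length (d # ds)) - 1 - int t))))"
      by blast
  qed
qed

lemma shifts_a_point_rotation:
  assumes "shifts_a_point (syllables H A B ds)" "set ds \<subseteq> {1, 2}" "length ds \<le> length es"
  obtains k where "ds = rotate k es"
proof -
  from assms(1) obtain i j where ij: "(i, j) \<in> X"
    and pt: "syllables H A B ds (i, j) = \<tau> (i, j)"
    by (auto simp: shifts_a_point_def)
  have i: "i mod (3 * n) = i" and j: "j < 3" using ij by (auto simp: X_iff)
  obtain s j' where s: "syllables H A B ds (i mod (3 * n), j) = ((i + s) mod (3 * n), j')" "j' < 3"
    "\<bar>s\<bar> \<le> int (length ds)"
    "s = - int (length ds) \<longrightarrow> (ds \<noteq> [] \<longrightarrow> j' = 0) \<and> (j = 0 \<longrightarrow> j' = 0 \<and>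
      (\<forall>t<length ds. ds ! t = \<epsilon> (i - (int (length ds) - 1 - int t))))"
    by (rule syllables_path[OF j assms(2), of i])
  have "((i + s) mod (3 * n), j') = ((i - n) mod (3 * n), j)"
    using pt s(1) ij by (simp add: i \<tau>_def)
  then have jj: "j' = j" and "(i + s) mod (3 * n) = (i - n) mod (3 * n)" by auto
  then have "3 * n dvd (i + s) - (i - n)" by (simp only: mod_eq_dvd_iff)
  then have "3 * n dvd s + n" by (simp add: algebra_simps)
  moreover have "\<bar>s + n\<bar> < 3 * n"
    using s(3) assms(3) n_pos unfolding n_def by linarith
  ultimately have "s + n = 0"
    using dvd_imp_le_int[of "s + n" "3 * n"] n_pos by auto
  then have "s = - n" by simp
  then have len: "length ds = length es" using s(3) assms(3) by (simp add: n_def)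
  then have "ds \<noteq> []" using nonempty by auto
  have sl: "s = - int (length ds)" using \<open>s = - n\<close> len by (simp add: n_def)
  have "j = 0" using s(4) sl jj \<open>ds \<noteq> []\<close> by simp
  then have ds: "ds ! t = \<epsilon> (i - (int (length ds) - 1 - int t))" if "t < length ds" for t
    using s(4) sl that by blast
  have "ds = rotate (nat (i + 1)) es"
  proof (rule nth_equalityI)
    show "length ds = length (rotate (nat (i + 1)) es)" by (simp add: len)
    fix t assume t: "t < length ds"
    have "(i - (int (length ds) - 1 - int t)) mod n = (i + 1 + int t - n) mod n"
      by (simp add: len n_def algebra_simps)
    also have "\<dots> = int ((nat (i + 1) + t) mod length es)"
      using ij by (simp add: X_iff n_def zmod_int)
    finally show "ds ! t = rotate (nat (i + 1)) es ! t"
      using t by (simp add: ds nth_rotate len \<epsilon>_def)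
  qed
  then show ?thesis by (rule that)
qed

lemma not_shifts_a_point_B_pow: "\<not> shifts_a_point (B [^]\<^bsub>H\<^esub> (d::nat))"
proof
  assume "shifts_a_point (B [^]\<^bsub>H\<^esub> (d::nat))"
  then obtain p where "p \<in> X" "(B [^]\<^bsub>H\<^esub> d) p = \<tau> p"
    by (auto simp: shifts_a_point_def)
  then show False using fst_\<tau>_neq[of p] B_pow[of "fst p" "snd p" d] by simp
qed

lemma not_shifts_a_point_A: "\<not> shifts_a_point A"
proof
  assume "shifts_a_point A"
  then obtain p where p: "p \<in> X" "A p = \<tau> p"
    by (auto simp: shifts_a_point_def)
  then show False
  proof (cases rule: X_cases)
    case spare
    then show False using fst_\<tau>_neq[OF p(1)] p(2) by (simp add: A_spare)
  qed (use p in \<open>auto simp: A_\<epsilon> A_0 \<tau>_X\<close>)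
qed

end

section \<open>Conjugacy separability of the braid group\<close>

text \<open>A locale cannot quantify over types, so \<open>lift\<close> is restricted to the type of the permutation groups
  above.\<close>

locale universal_square_eq_cube = square_eq_cube +
  fixes e
  assumes e: "e \<in> hom G integer_group" and e_a: "e a = 3" and e_b: "e b = 2"
    and lift: "\<And>H :: (int \<times> nat \<Rightarrow> int \<times> nat) monoid. \<And>x y.
      group H \<Longrightarrow> x \<in> carrier H \<Longrightarrow> y \<in> carrier H \<Longrightarrow>
      x \<otimes>\<^bsub>H\<^esub> x = \<one>\<^bsub>H\<^esub> \<Longrightarrow> y \<otimes>\<^bsub>H\<^esub> (y \<otimes>\<^bsub>H\<^esub> y) = \<one>\<^bsub>H\<^esub> \<Longrightarrow> \<exists>\<phi> \<in> hom G H. \<phi> a = x \<and> \<phi> b = y"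
begin

lemma syllables_rotation:
  assumes gh: "g \<in> carrier G" "h \<in> carrier G" "conjugate_in_finite_quotients G g h"
    and es: "es \<noteq> []" "set es \<subseteq> {1, 2}" and g: "conj_mod_Z g (w es)"
    and h: "conj_mod_Z h t" and t: "t \<in> carrier G"
  shows "t \<notin> {a, b, b [^] (2::nat)}"
    and "t = w ds \<Longrightarrow> set ds \<subseteq> {1, 2} \<Longrightarrow> length ds \<le> length es \<Longrightarrow> \<exists>k. ds = rotate k es"
proof -
  note group_G = is_group
  interpret cyclic_word_action es by unfold_locales fact+
  obtain \<phi> where \<phi>: "\<phi> \<in> hom G H" and ab: "\<phi> a = A" "\<phi> b = B"
    using lift[OF group_H A_H B_H] by (auto simp: fun_eq_iff)
  interpret group_hom G H \<phi>
    using \<phi> group_H by (simp add: group_hom_def group_hom_axioms_def)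
  have AA_one: "\<phi> a \<otimes>\<^bsub>H\<^esub> \<phi> a = \<one>\<^bsub>H\<^esub>" by (simp add: ab fun_eq_iff)
  have "conjugate_in H (\<phi> g) (\<phi> (w es))"
    by (rule hom_conj_mod_Z[OF \<phi> group_H AA_one gh(1) g])
  then have 1: "conjugate_in H (\<phi> (w es)) (\<phi> g)"
    by (rule conjugate_in_sym[OF group_H hom_closed[OF gh(1)]])
  have 2: "conjugate_in H (\<phi> g) (\<phi> h)"
    by (rule conjugate_in_finite_image[OF \<phi> group_G group_H finite_H gh(1,2)])
      (use gh(3) in \<open>simp add: conjugate_in_finite_quotients_def\<close>)
  have 3: "conjugate_in H (\<phi> h) (\<phi> t)"
    by (rule hom_conj_mod_Z[OF \<phi> group_H AA_one gh(2) h])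
  have "conjugate_in H (\<phi> (w es)) (\<phi> t)"
    using conjugate_in_trans[OF group_H _ conjugate_in_trans[OF group_H _ 1 2] 3]
    by (simp add: hom_closed)
  moreover have w: "\<phi> (w ds) = syllables H A B ds" for ds
    by (simp add: hom_syllables ab)
  ultimately have shift: "shifts_a_point (\<phi> t)"
    using shifts_a_point_conjugate shifts_a_point_syllables group_H
    by (metis A_H B_H group.syllables_closed)
  have "\<phi> (b [^] (2::nat)) = B [^]\<^bsub>H\<^esub> (2::nat)"
    by (simp add: hom_nat_pow ab del: nat_pow_Suc)
  moreover have "\<not> shifts_a_point B"
    using not_shifts_a_point_B_pow[of 1] by simp
  ultimately show "t \<notin> {a, b, b [^] (2::nat)}"
    using shift not_shifts_a_point_A not_shifts_a_point_B_pow ab by auto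
  show "\<exists>k. ds = rotate k es" if "t = w ds" "set ds \<subseteq> {1, 2}" "length ds \<le> length es"
    using shifts_a_point_rotation[of ds] that shift w by metis
qed

lemma syllables_conj_mod_Z:
  assumes "g \<in> carrier G" "h \<in> carrier G" "conjugate_in_finite_quotients G g h"
    and "set es \<subseteq> {1, 2}" "conj_mod_Z g (w es)" "set ds \<subseteq> {1, 2}" "conj_mod_Z h (w ds)"
    and "length ds \<le> length es"
  shows "conj_mod_Z (w es) (w ds)"
proof (cases "es = []")
  case True
  then show ?thesis using assms(8) conj_mod_Z_rotate[of "[]" 0] by simp
next
  case False
  then obtain k where "ds = rotate k es"
    using syllables_rotation(2)[OF assms(1-3) False assms(4,5,7)] assms by auto
  then show ?thesis using conj_mod_Z_rotate by simp
qed

lemma conjugacy_separable: "conjugacy_separable G"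
proof -
  have "conjugate_in G g h"
    if g: "g \<in> carrier G" and h: "h \<in> carrier G" and gh: "conjugate_in_finite_quotients G g h" for g h
  proof -
    have e_gh: "e g = e h"
      by (rule integer_hom_eq_if_conjugate_in_finite_quotients[OF is_group e g h gh])
    have hg: "conjugate_in_finite_quotients G h g"
      by (rule conjugate_in_finite_quotients_sym[OF g gh])
    obtain t where t: "t \<in> cyclic_forms" "conj_mod_Z g t" by (rule conj_cyclic_form[OF g])
    obtain u where u: "u \<in> cyclic_forms" "conj_mod_Z h u" by (rule conj_cyclic_form[OF h])
    have tc: "t \<in> carrier G" and uc: "u \<in> carrier G"
      using t u cyclic_forms_closed by auto
    let ?T = "{a, b, b [^] (2::nat)}"
    consider "t \<in> insert \<one> ?T" "u \<in> insert \<one> ?T"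
      | es where "es \<noteq> []" "set es \<subseteq> {1, 2}" "t = w es" "u \<in> ?T"
      | ds where "ds \<noteq> []" "set ds \<subseteq> {1, 2}" "u = w ds" "t \<in> ?T"
      | es ds where "set es \<subseteq> {1, 2}" "t = w es" "set ds \<subseteq> {1, 2}" "u = w ds"
      using t(1) u(1) unfolding cyclic_forms_def
      by (elim UnE imageE CollectE) (metis insertCI syllables.simps(1))+
    then have "conj_mod_Z t u"
    proof cases
      case 1
      interpret e: group_hom G integer_group e
        using e by (simp add: group_hom_def group_hom_axioms_def)
      obtain k where "e t = e g + 2 * k * e a" by (rule integer_hom_conj_mod_Z[OF e g t(2)])
      moreover obtain l where "e u = e h + 2 * l * e a" by (rule integer_hom_conj_mod_Z[OF e h u(2)])
      ultimately have "6 dvd e t - e u"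
        using e_gh e_a by (auto intro: dvdI[of _ _ "k - l"])
      moreover have "e (b [^] (2::nat)) = 4"
        using e.hom_nat_pow[OF b, of 2] by (simp add: e_b)
      ultimately have "t = u"
        using 1 e_a e_b e.hom_one by auto
      then show ?thesis
        using conj_mod_Z_mult[of \<one> t] tc by simp
    next
      case 2
      then show ?thesis using syllables_rotation(1)[OF g h gh _ _ _ u(2) uc] t by blast
    next
      case 3
      then show ?thesis using syllables_rotation(1)[OF h g hg _ _ _ t(2) tc] u by blast
    next
      case (4 es ds)
      show ?thesis
      proof (cases "length ds \<le> length es")
        case True
        then show ?thesis using syllables_conj_mod_Z[OF g h gh, of es ds] 4 t u by blast
      next
        case False
        then have "conj_mod_Z u t"
          using syllables_conj_mod_Z[OF h g hg, of ds es] 4 t u by simp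
        then show ?thesis using conj_mod_Z_sym uc by blast
      qed
    qed
    then have "conj_mod_Z g u"
      using t conj_mod_Z_trans g by blast
    then have "conj_mod_Z g h"
      using conj_mod_Z_trans conj_mod_Z_sym g h u by blast
    then obtain k where "e h = e g + 2 * k * e a" "k = 0 \<Longrightarrow> conjugate_in G g h"
      using integer_hom_conj_mod_Z[OF e g] by blast
    then show ?thesis using e_gh e_a by simp
  qed
  then show ?thesis
    by (auto simp: conjugacy_separable_def conjugate_in_finite_quotients_def is_group)
qed

end

abbreviation braid_relations where
  "braid_relations \<equiv>
     {([(True, \<sigma>\<^sub>1), (True, \<sigma>\<^sub>2), (True, \<sigma>\<^sub>1)], [(True, \<sigma>\<^sub>2), (True, \<sigma>\<^sub>1), (True, \<sigma>\<^sub>2)])}"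

abbreviation braid_word :: "braid_gen gword \<Rightarrow> braid_gen gword set" where
  "braid_word \<equiv> pres_class braid_relations"

lemma mult_braid_word: "braid_word u \<otimes>\<^bsub>B\<^sub>3\<^esub> braid_word v = braid_word (u @ v)"
  by (simp add: braid_group_3_def mult_presented_group)

lemma carrier_B3: "carrier B\<^sub>3 = range braid_word"
  by (simp add: braid_group_3_def carrier_presented_group)

lemma one_B3: "\<one>\<^bsub>B\<^sub>3\<^esub> = braid_word []"
  by (simp add: braid_group_3_def one_presented_group)

lemma braid_word_rel:
  "braid_word (u @ [(True, \<sigma>\<^sub>1), (True, \<sigma>\<^sub>2), (True, \<sigma>\<^sub>1)] @ v) =
   braid_word (u @ [(True, \<sigma>\<^sub>2), (True, \<sigma>\<^sub>1), (True, \<sigma>\<^sub>2)] @ v)"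
  unfolding pres_class_eq_iff
  by (intro pres_eq.append pres_eq.refl pres_eq.rel) simp

lemma B3_hom:
  assumes "group H" "s\<^sub>1 \<in> carrier H" "s\<^sub>2 \<in> carrier H"
    and "s\<^sub>1 \<otimes>\<^bsub>H\<^esub> (s\<^sub>2 \<otimes>\<^bsub>H\<^esub> s\<^sub>1) = s\<^sub>2 \<otimes>\<^bsub>H\<^esub> (s\<^sub>1 \<otimes>\<^bsub>H\<^esub> s\<^sub>2)"
  obtains \<phi> where "\<phi> \<in> hom B\<^sub>3 H"
    and "\<phi> (braid_word [(True, \<sigma>\<^sub>1), (True, \<sigma>\<^sub>2), (True, \<sigma>\<^sub>1)]) = s\<^sub>1 \<otimes>\<^bsub>H\<^esub> (s\<^sub>2 \<otimes>\<^bsub>H\<^esub> s\<^sub>1)"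
    and "\<phi> (braid_word [(True, \<sigma>\<^sub>1), (True, \<sigma>\<^sub>2)]) = s\<^sub>1 \<otimes>\<^bsub>H\<^esub> s\<^sub>2"
proof -
  interpret group H by fact
  let ?s = "case_braid_gen s\<^sub>1 s\<^sub>2"
  have s: "range ?s \<subseteq> carrier H"
    using assms(2,3) by (auto split: braid_gen.split)
  obtain \<phi> where "\<phi> \<in> hom (presented_group braid_relations) H"
    and "\<And>u. \<phi> (braid_word u) = eval_gword H ?s u"
    by (rule presented_group_hom[OF s, of braid_relations]) (use assms in auto)
  then show ?thesis
    using assms by (intro that[of \<phi>]) (simp_all add: braid_group_3_def)
qed

lemma B3_generate:
  "carrier B\<^sub>3 = generate B\<^sub>3 {braid_word [(True, \<sigma>\<^sub>1), (True, \<sigma>\<^sub>2), (True, \<sigma>\<^sub>1)],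
    braid_word [(True, \<sigma>\<^sub>1), (True, \<sigma>\<^sub>2)]}" (is "_ = generate _ {?a, ?b}")
proof
  interpret group "B\<^sub>3" by (rule group_braid_group_3)
  have closed [simp]: "braid_word u \<in> carrier B\<^sub>3" for u by (simp add: carrier_B3)
  show "generate B\<^sub>3 {?a, ?b} \<subseteq> carrier B\<^sub>3"
    by (rule generate_incl) auto
  have gens: "?a \<in> generate B\<^sub>3 {?a, ?b}" "?b \<in> generate B\<^sub>3 {?a, ?b}"
      "inv\<^bsub>B\<^sub>3\<^esub> ?b \<in> generate B\<^sub>3 {?a, ?b}"
    by (auto intro: generate.intros)
  have "braid_word [(True, \<sigma>\<^sub>1)] = inv\<^bsub>B\<^sub>3\<^esub> ?b \<otimes>\<^bsub>B\<^sub>3\<^esub> ?a"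
    by (subst inv_solve_left) (auto simp: mult_braid_word)
  moreover have "braid_word [(True, \<sigma>\<^sub>2)] = ?a \<otimes>\<^bsub>B\<^sub>3\<^esub> inv\<^bsub>B\<^sub>3\<^esub> ?b"
    using braid_word_rel[of "[]" "[]"]
    by (subst inv_solve_right) (auto simp: mult_braid_word)
  ultimately have pos: "braid_word [(True, x)] \<in> generate B\<^sub>3 {?a, ?b}" for x
    using gens by (cases x) (auto intro: generate.eng)
  have inv: "braid_word [(False, x)] = inv\<^bsub>B\<^sub>3\<^esub> (braid_word [(True, x)])" for x
    using pres_eq.cancel[of braid_relations False x]
    by (intro inv_equality[symmetric]) (auto simp: mult_braid_word one_B3 pres_class_eq_iff)
  have letter: "braid_word [(p, x)] \<in> generate B\<^sub>3 {?a, ?b}" for p x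
    using pos inv generate_m_inv_closed[of "{?a, ?b}"] by (cases p) auto
  have "braid_word u \<in> generate B\<^sub>3 {?a, ?b}" for u
  proof (induction u)
    case Nil
    then show ?case using generate.one[of "B\<^sub>3"] by (simp add: one_B3)
  next
    case (Cons l u)
    then have "braid_word [l] \<otimes>\<^bsub>B\<^sub>3\<^esub> braid_word u \<in> generate B\<^sub>3 {?a, ?b}"
      using letter by (cases l) (auto intro: generate.eng)
    then show ?case by (simp add: mult_braid_word)
  qed
  then show "carrier B\<^sub>3 \<subseteq> generate B\<^sub>3 {?a, ?b}" by (auto simp: carrier_B3)
qed

theorem theorem1p4:
  shows "conjugacy_separable B\<^sub>3"
proof -
  let ?a = "braid_word [(True, \<sigma>\<^sub>1), (True, \<sigma>\<^sub>2), (True, \<sigma>\<^sub>1)]"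
  let ?b = "braid_word [(True, \<sigma>\<^sub>1), (True, \<sigma>\<^sub>2)]"
  obtain e where e: "e \<in> hom B\<^sub>3 integer_group" "e ?a = 3" "e ?b = 2"
    by (rule B3_hom[of integer_group 1 1]) auto
  have "universal_square_eq_cube B\<^sub>3 ?a ?b e"
  proof (intro universal_square_eq_cube.intro square_eq_cube.intro
      square_eq_cube_axioms.intro universal_square_eq_cube_axioms.intro
      group_braid_group_3 B3_generate e)
    show "?a \<otimes>\<^bsub>B\<^sub>3\<^esub> ?a = ?b \<otimes>\<^bsub>B\<^sub>3\<^esub> (?b \<otimes>\<^bsub>B\<^sub>3\<^esub> ?b)"
      using braid_word_rel[of "[(True, \<sigma>\<^sub>1), (True, \<sigma>\<^sub>2), (True, \<sigma>\<^sub>1)]" "[]"]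
      by (simp add: mult_braid_word)
  next
    fix H :: "(int \<times> nat \<Rightarrow> int \<times> nat) monoid" and x y
    assume "group H" and x: "x \<in> carrier H" "x \<otimes>\<^bsub>H\<^esub> x = \<one>\<^bsub>H\<^esub>"
      and y: "y \<in> carrier H" "y \<otimes>\<^bsub>H\<^esub> (y \<otimes>\<^bsub>H\<^esub> y) = \<one>\<^bsub>H\<^esub>"
    interpret group H by fact
    have xx: "x \<otimes>\<^bsub>H\<^esub> (x \<otimes>\<^bsub>H\<^esub> u) = u" if "u \<in> carrier H" for u
      using x that by (simp add: m_assoc[symmetric])
    have yyy: "y \<otimes>\<^bsub>H\<^esub> (y \<otimes>\<^bsub>H\<^esub> (y \<otimes>\<^bsub>H\<^esub> u)) = u" if "u \<in> carrier H" for u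
    proof -
      have "(y \<otimes>\<^bsub>H\<^esub> (y \<otimes>\<^bsub>H\<^esub> y)) \<otimes>\<^bsub>H\<^esub> u = u" using y that by simp
      then show ?thesis using y(1) that by (simp add: m_assoc)
    qed
    obtain \<phi> where "\<phi> \<in> hom B\<^sub>3 H"
      "\<phi> ?a = (y \<otimes>\<^bsub>H\<^esub> (y \<otimes>\<^bsub>H\<^esub> x)) \<otimes>\<^bsub>H\<^esub> ((x \<otimes>\<^bsub>H\<^esub> (y \<otimes>\<^bsub>H\<^esub> y)) \<otimes>\<^bsub>H\<^esub> (y \<otimes>\<^bsub>H\<^esub> (y \<otimes>\<^bsub>H\<^esub> x)))"
      "\<phi> ?b = (y \<otimes>\<^bsub>H\<^esub> (y \<otimes>\<^bsub>H\<^esub> x)) \<otimes>\<^bsub>H\<^esub> (x \<otimes>\<^bsub>H\<^esub> (y \<otimes>\<^bsub>H\<^esub> y))"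
      by (rule B3_hom[of H "y \<otimes>\<^bsub>H\<^esub> (y \<otimes>\<^bsub>H\<^esub> x)" "x \<otimes>\<^bsub>H\<^esub> (y \<otimes>\<^bsub>H\<^esub> y)"])
        (use x y \<open>group H\<close> in \<open>simp_all add: m_assoc xx yyy\<close>)
    then show "\<exists>\<phi>\<in>hom B\<^sub>3 H. \<phi> ?a = x \<and> \<phi> ?b = y"
      using x y by (auto simp: m_assoc xx yyy)
  qed (simp_all add: carrier_B3)
  then show ?thesis by (rule universal_square_eq_cube.conjugacy_separable)
qed

end
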